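(* Let $X$ be an infinite $\mathsf{T}_1$ Lindelöf topological space. Then the following are equivalent: (1) $X$ is almost Menger, i.e. $X$ has the property $\mathsf{S}_{fin}(\mathcal{O},\overline{\mathcal{O}})$. (2) Player ONE does not have a winning strategy in the game $\mathsf{G}_{fin}^{\omega}(\mathcal{O},\overline{\mathcal{O}})$ on $X$.
   Context: A space is Lindelöf if each open cover has a countable subset that covers the space (no separation axiom is included in the definition). For a topological space $X$: $\mathcal{O}$ is the collection of all open covers of $X$; $\overline{\mathcal{O}}$ is the collection of families $\mathcal{U}$ of open subsets of $X$ for which $\{\overline{U}:U\in\mathcal{U}\}$ covers $X$, where $\overline{U}$ is the closure of $U$. Let $\mathcal{A},\mathcal{B}$ be collections of families of sets. $\mathsf{S}_{fin}(\mathcal{A},\mathcal{B})$ is the statement: for each sequence $(A_n:n\in\mathbb{N})$ of elements of $\mathcal{A}$ there is a sequence $(B_n:n\in\mathbb{N})$ such that each $B_n$ is a finite subset of $A_n$ and $\bigcup\{B_n:n\in\mathbb{N}\}\in\mathcal{B}$. The game $\mathsf{G}_{fin}^{\omega}(\mathcal{A},\mathcal{B})$: players ONE and TWO play an inning for each $n<\omega$. In inning $n$ ONE first chooses $O_n\in\mathcal{A}$, then TWO responds with a finite subset $T_n$ of $O_n$. TWO wins the play if $\bigcup_{n<\omega}T_n\in\mathcal{B}$; otherwise ONE wins. A strategy of a player prescribes that player's next move as a function of the opponent's moves so far; it is winning if every play in which the player follows it is won by that player. *)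

theory Defs
  imports "HOL-Analysis.Analysis"
begin

definition open_covers :: "'a topology \<Rightarrow> 'a set set set" where
  "open_covers X = {\<U>. (\<forall>U\<in>\<U>. openin X U) \<and> \<Union>\<U> = topspace X}"

definition almost_open_covers :: "'a topology \<Rightarrow> 'a set set set" where
  "almost_open_covers X =
     {\<U>. (\<forall>U\<in>\<U>. openin X U) \<and> (\<Union>U\<in>\<U>. X closure_of U) = topspace X}"

definition S_fin :: "'b set set \<Rightarrow> 'b set set \<Rightarrow> bool" where
  "S_fin \<A> \<B> \<longleftrightarrow>
     (\<forall>A :: nat \<Rightarrow> 'b set. (\<forall>n. A n \<in> \<A>) \<longrightarrow>
        (\<exists>B :: nat \<Rightarrow> 'b set. (\<forall>n. finite (B n) \<and> B n \<subseteq> A n) \<and> (\<Union>n. B n) \<in> \<B>))"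

definition almost_Menger :: "'a topology \<Rightarrow> bool" where
  "almost_Menger X \<longleftrightarrow> S_fin (open_covers X) (almost_open_covers X)"

definition G_fin_play :: "'b set set \<Rightarrow> (nat \<Rightarrow> 'b set) \<Rightarrow> (nat \<Rightarrow> 'b set) \<Rightarrow> bool" where
  "G_fin_play \<A> O' T \<longleftrightarrow> (\<forall>n. O' n \<in> \<A> \<and> finite (T n) \<and> T n \<subseteq> O' n)"

definition TWO_wins :: "'b set set \<Rightarrow> (nat \<Rightarrow> 'b set) \<Rightarrow> bool" where
  "TWO_wins \<B> T \<longleftrightarrow> (\<Union>n. T n) \<in> \<B>"

(* A strategy F of ONE maps the list of TWO's moves so far, in chronological order,
   to ONE's next move. Only its values on lists ts of legal answers to F matter, and
   there the prescribed move has to be legal. *)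

definition legal_answers :: "('b set list \<Rightarrow> 'b set) \<Rightarrow> 'b set list \<Rightarrow> bool" where
  "legal_answers F ts \<longleftrightarrow>
     (\<forall>n < length ts. finite (ts ! n) \<and> ts ! n \<subseteq> F (take n ts))"

definition ONE_strategy :: "'b set set \<Rightarrow> ('b set list \<Rightarrow> 'b set) \<Rightarrow> bool" where
  "ONE_strategy \<A> F \<longleftrightarrow> (\<forall>ts. legal_answers F ts \<longrightarrow> F ts \<in> \<A>)"

definition ONE_winning_strategy ::
    "'b set set \<Rightarrow> 'b set set \<Rightarrow> ('b set list \<Rightarrow> 'b set) \<Rightarrow> bool" where
  "ONE_winning_strategy \<A> \<B> F \<longleftrightarrow>
     ONE_strategy \<A> F \<and>
     (\<forall>O' T. G_fin_play \<A> O' T \<and> (\<forall>n. O' n = F (map T [0..<n])) \<longrightarrow> \<not> TWO_wins \<B> T)"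

end

theory Submission
  imports Defs
begin

text \<open>
  For the hard direction, Lindelofness lets TWO restrict to the moves
  \<open>T ts 0 \<subseteq> T ts 1 \<subseteq> \<dots>\<close>, finite initial segments of a countable subcover of ONE's move
  after \<open>ts\<close>. Let \<open>U \<sigma>\<close> be the set that TWO has covered after playing according to the finite
  sequence \<open>\<sigma>\<close> of indices. The sets \<open>W n k = (\<Inter>\<tau>. U (\<tau> @ [k]))\<close>, where \<open>\<tau>\<close> has length at most
  \<open>n\<close>, increase with \<open>k\<close>. They are open: by monotonicity only those \<open>\<tau>\<close> with
  entries at most \<open>k\<close> matter. For fixed \<open>n\<close> they cover the space, because a point lies outside
  \<open>U \<tau>\<close> for only finitely many \<open>\<tau>\<close> of length at most \<open>n\<close>. Applying the almost Menger property to
  the covers \<open>{W n k | k}\<close> yields indices \<open>f n\<close> such that the closures of the sets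
  \<open>W n (f n)\<close> cover; as \<open>W n (f n) \<subseteq> U (f 0, \<dots>, f n)\<close>, TWO wins by playing according to \<open>f\<close>.
\<close>

section \<open>Trees of sets growing along branches and with the last index\<close>

lemma tree_mono_append:
  assumes "\<And>\<sigma> k. U \<sigma> \<subseteq> U (\<sigma> @ [k])"
  shows "U \<sigma> \<subseteq> U (\<sigma> @ \<tau>)"
proof (induction \<tau> rule: rev_induct)
  case (snoc k \<tau>)
  then show ?case using assms[of "\<sigma> @ \<tau>" k] by simp
qed simp

definition level_Inter :: "(nat list \<Rightarrow> 'a set) \<Rightarrow> nat \<Rightarrow> nat \<Rightarrow> 'a set" where
  "level_Inter U n k = (\<Inter>\<tau>\<in>{\<tau>. length \<tau> \<le> n}. U (\<tau> @ [k]))"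

lemma level_Inter_mono:
  assumes "\<And>\<sigma> i j. i \<le> j \<Longrightarrow> U (\<sigma> @ [i]) \<subseteq> U (\<sigma> @ [j])" and "i \<le> j"
  shows "level_Inter U n i \<subseteq> level_Inter U n j"
  unfolding level_Inter_def using assms by (intro INT_anti_mono) auto

text \<open>Raising the last index from \<open>k\<close> to \<open>\<tau> ! m\<close> enlarges the
  set by \<open>mono\<close>, and appending the remaining entries of \<open>\<tau>\<close> enlarges
  it again by \<open>ext\<close>.\<close>

lemma mem_tree_if_large_entry:
  assumes ext: "\<And>\<sigma> k. U \<sigma> \<subseteq> U (\<sigma> @ [k])"
    and mono: "\<And>\<sigma> i j. i \<le> j \<Longrightarrow> U (\<sigma> @ [i]) \<subseteq> U (\<sigma> @ [j])"
    and x: "x \<in> U (take m \<tau> @ [k])" and m: "m < length \<tau>" "k \<le> \<tau> ! m"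
  shows "x \<in> U \<tau>"
proof -
  have "x \<in> U (take m \<tau> @ [\<tau> ! m])"
    using mono[OF m(2)] x by blast
  moreover have "\<tau> = (take m \<tau> @ [\<tau> ! m]) @ drop (Suc m) \<tau>"
    using m(1) by (simp add: id_take_nth_drop)
  ultimately show ?thesis
    using tree_mono_append[of U "take m \<tau> @ [\<tau> ! m]" "drop (Suc m) \<tau>"] ext by auto
qed

text \<open>If \<open>\<tau>\<close> has an entry above \<open>k\<close>, its condition follows from
  that of the prefix before this entry. Induction on the length therefore reduces everything to the
  sequences with entries at most \<open>k\<close>.\<close>

lemma level_Inter_eq_finite_Inter:
  assumes ext: "\<And>\<sigma> k. U \<sigma> \<subseteq> U (\<sigma> @ [k])"
    and mono: "\<And>\<sigma> i j. i \<le> j \<Longrightarrow> U (\<sigma> @ [i]) \<subseteq> U (\<sigma> @ [j])"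
  shows "level_Inter U n k = (\<Inter>\<tau>\<in>{\<tau>. set \<tau> \<subseteq> {..k} \<and> length \<tau> \<le> n}. U (\<tau> @ [k]))"
    (is "_ = ?R")
proof
  show "?R \<subseteq> level_Inter U n k"
  proof
    fix x assume x: "x \<in> ?R"
    have "x \<in> U (\<tau> @ [k])" if "length \<tau> \<le> n" for \<tau>
      using that
    proof (induction \<tau> rule: length_induct)
      case (1 \<tau>)
      show ?case
      proof (cases "set \<tau> \<subseteq> {..k}")
        case True
        then show ?thesis using x 1 by blast
      next
        case False
        then obtain m where m: "m < length \<tau>" "k \<le> \<tau> ! m"
          by (auto simp: subset_iff in_set_conv_nth not_le intro: less_imp_le)
        have "x \<in> U (take m \<tau> @ [k])"
          using 1 m(1) by simp
        then have "x \<in> U \<tau>"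
          using mem_tree_if_large_entry[of U, OF ext mono] m by blast
        then show ?thesis using ext by blast
      qed
    qed
    then show "x \<in> level_Inter U n k"
      by (simp add: level_Inter_def)
  qed
qed (auto simp: level_Inter_def)

lemma openin_level_Inter:
  assumes "\<And>\<sigma>. openin X (U \<sigma>)"
    and "\<And>\<sigma> k. U \<sigma> \<subseteq> U (\<sigma> @ [k])"
    and "\<And>\<sigma> i j. i \<le> j \<Longrightarrow> U (\<sigma> @ [i]) \<subseteq> U (\<sigma> @ [j])"
  shows "openin X (level_Inter U n k)"
proof -
  have "finite {\<tau>. set \<tau> \<subseteq> {..k} \<and> length \<tau> \<le> n}"
    by (rule finite_lists_length_le) simp
  \<comment> \<open>The index set must be nonempty: an empty intersection would be
    \<open>UNIV\<close>.\<close>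
  moreover have "[] \<in> {\<tau>. set \<tau> \<subseteq> {..k} \<and> length \<tau> \<le> n}"
    by simp
  ultimately have "openin X (\<Inter>\<tau>\<in>{\<tau>. set \<tau> \<subseteq> {..k} \<and> length \<tau> \<le> n}. U (\<tau> @ [k]))"
    using assms(1) by (intro openin_INT2) blast+
  then show ?thesis
    by (subst level_Inter_eq_finite_Inter[of U, OF assms(2,3)])
qed

text \<open>Suppose \<open>k\<close> works for length \<open>n\<close>. A sequence of length at most
  \<open>Suc n\<close> with an entry above \<open>k\<close> is settled by the prefix before that
  entry, which has length at most \<open>n\<close>. Only finitely many sequences remain, and one
  \<open>l\<close> bounds the indices they need.\<close>

lemma mem_level_Inter:
  assumes ext: "\<And>\<sigma> k. U \<sigma> \<subseteq> U (\<sigma> @ [k])"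
    and mono: "\<And>\<sigma> i j. i \<le> j \<Longrightarrow> U (\<sigma> @ [i]) \<subseteq> U (\<sigma> @ [j])"
    and cover: "\<And>\<sigma>. \<exists>k. x \<in> U (\<sigma> @ [k])"
  shows "\<exists>k. x \<in> level_Inter U n k"
proof (induction n)
  case 0
  then show ?case using cover[of "[]"] by (simp add: level_Inter_def)
next
  case (Suc n)
  then obtain k where k: "x \<in> level_Inter U n k" by blast
  obtain g where g: "\<And>\<sigma>. x \<in> U (\<sigma> @ [g \<sigma>])"
    using cover by metis
  define S where "S = {\<tau>. set \<tau> \<subseteq> {..k} \<and> length \<tau> \<le> Suc n}"
  have "finite (g ` S)"
    unfolding S_def by (intro finite_imageI finite_lists_length_le) simp
  then obtain l where l: "\<forall>i\<in>g ` S. i \<le> l"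
    by (auto simp: finite_nat_set_iff_bounded_le)
  have "x \<in> U (\<tau> @ [l])" if len: "length \<tau> \<le> Suc n" for \<tau>
  proof (cases "set \<tau> \<subseteq> {..k}")
    case True
    then have "g \<tau> \<le> l" using l len by (simp add: S_def)
    then show ?thesis using g mono by blast
  next
    case False
    then obtain m where m: "m < length \<tau>" "k \<le> \<tau> ! m"
      by (auto simp: subset_iff in_set_conv_nth not_le intro: less_imp_le)
    then have "x \<in> U (take m \<tau> @ [k])"
      using k len by (simp add: level_Inter_def)
    then have "x \<in> U \<tau>"
      using mem_tree_if_large_entry[of U, OF ext mono] m by blast
    then show ?thesis using ext by blast
  qed
  then show ?case by (auto simp: level_Inter_def)
qed

lemma almost_Menger_branch:
  fixes U :: "nat list \<Rightarrow> 'a set"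
  assumes "almost_Menger X"
    and op: "\<And>\<sigma>. openin X (U \<sigma>)"
    and ext: "\<And>\<sigma> k. U \<sigma> \<subseteq> U (\<sigma> @ [k])"
    and mono: "\<And>\<sigma> i j. i \<le> j \<Longrightarrow> U (\<sigma> @ [i]) \<subseteq> U (\<sigma> @ [j])"
    and cover: "\<And>\<sigma>. topspace X \<subseteq> (\<Union>k. U (\<sigma> @ [k]))"
  obtains f where "topspace X \<subseteq> (\<Union>n. X closure_of U (map f [0..<Suc n]))"
proof -
  define W where "W = level_Inter U"
  have opW: "openin X (W n k)" for n k
    unfolding W_def using op ext mono by (rule openin_level_Inter)
  have monoW: "W n i \<subseteq> W n j" if "i \<le> j" for n i j
    unfolding W_def using mono that by (rule level_Inter_mono)
  have "\<exists>k. x \<in> W n k" if "x \<in> topspace X" for x n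
    unfolding W_def using that cover by (intro mem_level_Inter ext mono) blast+
  then have "range (W n) \<in> open_covers X" for n
    using opW openin_subset by (fastforce simp: open_covers_def)
  then obtain B where B: "\<And>n. finite (B n)" "\<And>n. B n \<subseteq> range (W n)"
    "(\<Union>n. B n) \<in> almost_open_covers X"
    using assms(1) unfolding almost_Menger_def S_fin_def by meson
  \<comment> \<open>Finitely many terms of the increasing sequence \<open>W n\<close> lie below a
    single one.\<close>
  have "\<exists>k. \<forall>b\<in>B n. b \<subseteq> W n k" for n
  proof -
    obtain K where K: "finite K" "B n = W n ` K"
      using B(1,2) by (meson finite_subset_image)
    then obtain k where "\<forall>i\<in>K. i \<le> k"
      by (auto simp: finite_nat_set_iff_bounded_le)
    then have "\<forall>b\<in>B n. b \<subseteq> W n k"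
      using K(2) monoW by auto
    then show ?thesis ..
  qed
  then obtain f where f: "\<And>n b. b \<in> B n \<Longrightarrow> b \<subseteq> W n (f n)"
    by metis
  \<comment> \<open>The sequence \<open>map f [0..<n]\<close> has length exactly \<open>n\<close>,
    so it is among those intersected in \<open>W n (f n)\<close>.\<close>
  have WU: "W n (f n) \<subseteq> U (map f [0..<Suc n])" for n
    by (auto simp: W_def level_Inter_def)
  have "topspace X \<subseteq> (\<Union>n. X closure_of U (map f [0..<Suc n]))"
  proof
    fix x assume "x \<in> topspace X"
    then have "x \<in> (\<Union>b\<in>\<Union>n. B n. X closure_of b)"
      using B(3) by (simp add: almost_open_covers_def)
    then obtain n b where b: "b \<in> B n" "x \<in> X closure_of b"
      by blast
    have "X closure_of b \<subseteq> X closure_of U (map f [0..<Suc n])"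
      using f[OF b(1)] WU[of n] by (intro closure_of_mono) (rule subset_trans)
    then show "x \<in> (\<Union>n. X closure_of U (map f [0..<Suc n]))"
      using b(2) by blast
  qed
  then show thesis by (rule that)
qed

section \<open>Reduction of the game to such a tree\<close>

lemma Lindelof_open_cover_exhaustion:
  assumes "Lindelof_space X" "topspace X \<noteq> {}" "\<U> \<in> open_covers X"
  obtains T :: "nat \<Rightarrow> 'a set set"
    where "\<And>k. finite (T k)" "\<And>k. T k \<subseteq> \<U>" "mono T" "(\<Union>k. \<Union>(T k)) = topspace X"
proof -
  have "\<forall>U\<in>\<U>. openin X U" "\<Union>\<U> = topspace X"
    using assms(3) by (simp_all add: open_covers_def)
  then obtain \<V> where V: "countable \<V>" "\<V> \<subseteq> \<U>" "\<Union>\<V> = topspace X"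
    using assms(1) unfolding Lindelof_space_def by meson
  with assms(2) have ne: "\<V> \<noteq> {}" by blast
  \<comment> \<open>\<open>from_nat_into\<close> enumerates a nonempty countable set, possibly with
    repetitions.\<close>
  define T where "T k = from_nat_into \<V> ` {..k}" for k
  show thesis
  proof (rule that[of T])
    show "finite (T k)" for k by (simp add: T_def)
    show "T k \<subseteq> \<U>" for k using from_nat_into[OF ne] V(2) by (auto simp: T_def)
    show "mono T" by (intro monoI) (auto simp: T_def)
    have "(\<Union>k. \<Union>(T k)) = \<Union>(range (from_nat_into \<V>))"
      by (auto simp: T_def)
    then show "(\<Union>k. \<Union>(T k)) = topspace X"
      using V(1,3) ne by simp
  qed
qed

lemma almost_Menger_imp_no_ONE_winning_strategy:
  assumes men: "almost_Menger X" and lin: "Lindelof_space X" and ne: "topspace X \<noteq> {}"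
  shows "\<not> ONE_winning_strategy (open_covers X) (almost_open_covers X) F"
proof
  assume win: "ONE_winning_strategy (open_covers X) (almost_open_covers X) F"
  have cov: "F ts \<in> open_covers X" if "legal_answers F ts" for ts
    using win that by (simp add: ONE_winning_strategy_def ONE_strategy_def)
  have "\<exists>T. legal_answers F ts \<longrightarrow> (\<forall>k::nat. finite (T k)) \<and> (\<forall>k. T k \<subseteq> F ts) \<and> mono T \<and>
      (\<Union>k. \<Union>(T k)) = topspace X" for ts
    using Lindelof_open_cover_exhaustion[OF lin ne cov] by metis
  then obtain T where T: "\<And>ts. legal_answers F ts \<Longrightarrow>
      (\<forall>k::nat. finite (T ts k)) \<and> (\<forall>k. T ts k \<subseteq> F ts) \<and> mono (T ts) \<and>
      (\<Union>k. \<Union>(T ts k)) = topspace X"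
    by metis
  \<comment> \<open>\<open>play \<sigma>\<close> lists TWO's moves when the indices are taken from
    \<open>\<sigma>\<close>; each move depends on the earlier ones through
    \<open>T ts\<close>.\<close>
  define play where "play = foldl (\<lambda>ts k. ts @ [T ts k]) []"
  have play_Nil: "play [] = []" and play_snoc: "play (\<sigma> @ [k]) = play \<sigma> @ [T (play \<sigma>) k]" for \<sigma> k
    by (simp_all add: play_def)
  have legal: "legal_answers F (play \<sigma>)" for \<sigma>
  proof (induction \<sigma> rule: rev_induct)
    case (snoc k \<sigma>)
    then show ?case
      using T[OF snoc] by (auto simp: legal_answers_def play_snoc nth_append less_Suc_eq)
  qed (simp add: play_Nil legal_answers_def)
  note T = T[OF legal]
  have T_open: "openin X V" if "V \<in> T (play \<sigma>) k" for V \<sigma> k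
    using that T cov[OF legal] by (fastforce simp: open_covers_def)
  define U where "U \<sigma> = \<Union>(\<Union>(set (play \<sigma>)))" for \<sigma>
  have U_snoc: "U (\<sigma> @ [k]) = U \<sigma> \<union> \<Union>(T (play \<sigma>) k)" for \<sigma> k
    by (auto simp: U_def play_snoc)
  have "openin X (U \<sigma>)" for \<sigma>
  proof (induction \<sigma> rule: rev_induct)
    case (snoc k \<sigma>)
    then show ?case unfolding U_snoc using T_open by (intro openin_Un openin_Union) blast+
  qed (simp add: U_def play_Nil)
  moreover have "U \<sigma> \<subseteq> U (\<sigma> @ [k])" for \<sigma> k
    by (simp add: U_snoc)
  moreover have "U (\<sigma> @ [i]) \<subseteq> U (\<sigma> @ [j])" if "i \<le> j" for \<sigma> i j
    using T[of \<sigma>] monoD[of "T (play \<sigma>)", OF _ that] unfolding U_snoc by blast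
  moreover have "topspace X \<subseteq> (\<Union>k. U (\<sigma> @ [k]))" for \<sigma>
    using T[of \<sigma>] unfolding U_snoc by blast
  ultimately obtain f where f: "topspace X \<subseteq> (\<Union>n. X closure_of U (map f [0..<Suc n]))"
    by (rule almost_Menger_branch[OF men, where U = U])
  define t where "t n = T (play (map f [0..<n])) (f n)" for n
  have play_t: "play (map f [0..<n]) = map t [0..<n]" for n
    by (induction n) (simp_all add: play_Nil play_snoc t_def)
  have t: "finite (t n)" "t n \<subseteq> F (map t [0..<n])" "F (map t [0..<n]) \<in> open_covers X" for n
    using T[of "map f [0..<n]"] cov[OF legal, of "map f [0..<n]"] by (auto simp: t_def play_t)
  have "(\<Union>n. t n) \<in> almost_open_covers X"
    unfolding almost_open_covers_def
  proof (intro CollectI conjI ballI)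
    show "openin X V" if "V \<in> (\<Union>n. t n)" for V
      using that T_open by (auto simp: t_def)
    have "x \<in> (\<Union>V\<in>\<Union>n. t n. X closure_of V)" if x: "x \<in> topspace X" for x
    proof -
      obtain n where n: "x \<in> X closure_of U (map f [0..<Suc n])"
        using x f by blast
      \<comment> \<open>Finiteness lets closure commute with the union, so a point in the closure of
        what TWO has covered lies in the closure of a single chosen set.\<close>
      have "finite (\<Union>(t ` {..<Suc n}))"
        using t(1) by simp
      moreover have "U (map f [0..<Suc n]) = \<Union>(\<Union>(t ` {..<Suc n}))"
        unfolding U_def play_t by (simp add: atLeast0LessThan del: upt_Suc)
      ultimately have "X closure_of U (map f [0..<Suc n]) =
          (\<Union>V\<in>\<Union>(t ` {..<Suc n}). X closure_of V)"
        by (simp only: closure_of_Union)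
      then show ?thesis using n by blast
    qed
    then show "(\<Union>V\<in>\<Union>n. t n. X closure_of V) = topspace X"
      using closure_of_subset_topspace[of X] by blast
  qed
  moreover have "\<not> TWO_wins (almost_open_covers X) t"
  proof -
    have "G_fin_play (open_covers X) (\<lambda>n. F (map t [0..<n])) t"
      using t by (simp add: G_fin_play_def)
    then show ?thesis
      using win unfolding ONE_winning_strategy_def by blast
  qed
  ultimately show False by (simp add: TWO_wins_def)
qed

section \<open>From the game to the selection principle\<close>

lemma no_ONE_winning_strategy_imp_S_fin:
  fixes \<A> \<B> :: "'b set set"
  assumes "\<nexists>F. ONE_winning_strategy \<A> \<B> F"
  shows "S_fin \<A> \<B>"
  unfolding S_fin_def
proof (intro allI impI)
  fix A :: "nat \<Rightarrow> 'b set" assume "\<forall>n. A n \<in> \<A>"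
  \<comment> \<open>ONE ignores TWO's answers and plays the given sequence, using only the inning
    number \<open>length ts\<close>. TWO's moves in a play won against this strategy are the
    required finite selections.\<close>
  then have "ONE_strategy \<A> (\<lambda>ts. A (length ts))"
    by (simp add: ONE_strategy_def)
  moreover have "\<not> ONE_winning_strategy \<A> \<B> (\<lambda>ts. A (length ts))"
    using assms by blast
  ultimately obtain O' T where "G_fin_play \<A> O' T" "\<forall>n. O' n = A n" "TWO_wins \<B> T"
    by (auto simp: ONE_winning_strategy_def)
  then show "\<exists>B. (\<forall>n. finite (B n) \<and> B n \<subseteq> A n) \<and> (\<Union>n. B n) \<in> \<B>"
    unfolding G_fin_play_def TWO_wins_def by metis
qed

theorem theorem28:
  fixes X :: "'a topology"
  assumes "infinite (topspace X)"
    and "t1_space X"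
    and "Lindelof_space X"
  shows "almost_Menger X \<longleftrightarrow>
         \<not> (\<exists>F. ONE_winning_strategy (open_covers X) (almost_open_covers X) F)"
proof
  assume "almost_Menger X"
  moreover have "topspace X \<noteq> {}" using assms(1) by auto
  ultimately show "\<not> (\<exists>F. ONE_winning_strategy (open_covers X) (almost_open_covers X) F)"
    using almost_Menger_imp_no_ONE_winning_strategy assms(3) by blast
next
  assume "\<not> (\<exists>F. ONE_winning_strategy (open_covers X) (almost_open_covers X) F)"
  then show "almost_Menger X"
    unfolding almost_Menger_def by (rule no_ONE_winning_strategy_imp_S_fin)
qed

end
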